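(* Let $X_1,\ldots,X_n$ ($n\ge1$) be i.i.d. real random variables with continuous cumulative distribution function $F$. Let $\widehat F_n(x)=\frac1n\sum_{i=1}^n\mathbf 1_{(-\infty,x]}(X_i)$ and $$\widehat b_n^{\mathrm{int}}=\widehat F_n^{-1}\left(\frac1n\sum_{i=1}^n\widehat F_n(X_i)\right).$$ Then, almost surely, $$\widehat b_n^{\mathrm{int}}=X_{(\lceil(n+1)/2\rceil)}.$$ Thus $\widehat b_n^{\mathrm{int}}$ is the sample median for odd $n$ and the upper middle order statistic $X_{(n/2+1)}$ for even $n$.
   Context: $\widehat F_n^{-1}(u)=\inf\{x\in\mathbb{R}:\widehat F_n(x)\ge u\}$ for $u\in(0,1]$ is the generalised inverse of the empirical CDF, and $X_{(1)}\le\cdots\le X_{(n)}$ are the order statistics of the sample. *)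

theory Defs
  imports "HOL-Probability.Probability"
begin

text \<open>A sample of size n is a function x of type nat to real, of which only the values
  at the indices 1, ..., n are used.\<close>

definition ecdf :: "nat \<Rightarrow> (nat \<Rightarrow> real) \<Rightarrow> real \<Rightarrow> real" where
  "ecdf n x t = (1 / real n) * (\<Sum>i=1..n. indicator {..t} (x i))"

text \<open>The infimum is that of the reals, so the value is meaningful only where the set is
  nonempty and bounded below; for an empirical CDF this holds for every u in (0,1].\<close>

definition gen_inverse :: "(real \<Rightarrow> real) \<Rightarrow> real \<Rightarrow> real" where
  "gen_inverse G u = Inf {t. u \<le> G t}"

text \<open>The rank k is counted from 1, list positions from 0; meaningful for k in {1..n}.\<close>

definition order_stat :: "nat \<Rightarrow> (nat \<Rightarrow> real) \<Rightarrow> nat \<Rightarrow> real" where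
  "order_stat n x k = sort (map x [1..<Suc n]) ! (k - 1)"

definition sample_median :: "nat \<Rightarrow> (nat \<Rightarrow> real) \<Rightarrow> real" where
  "sample_median n x =
     (if odd n then order_stat n x ((n + 1) div 2)
      else (order_stat n x (n div 2) + order_stat n x (n div 2 + 1)) / 2)"

definition b_int :: "nat \<Rightarrow> (nat \<Rightarrow> real) \<Rightarrow> real" where
  "b_int n x = gen_inverse (ecdf n x) ((1 / real n) * (\<Sum>i=1..n. ecdf n x (x i)))"

end

theory Submission
  imports Defs
begin

text \<open>Independence and the absence of atoms exclude ties almost surely. Without ties the sample
  point of rank k has empirical CDF value k/n, so the mean of these values is (n+1)/(2n). Since
  the empirical CDF reaches the level u at t iff at least nu sample points are at most t, its
  generalised inverse at (n+1)/(2n) is the order statistic of rank n div 2 + 1.\<close>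

text \<open>Sorting only permutes the multiset of sample values. Both the empirical CDF and the mean
  of its values at the sample thereby become sums over positions in the sorted list.\<close>

lemma sum_sample_conv_sort:
  fixes f :: "real \<Rightarrow> 'b::comm_monoid_add"
  shows "(\<Sum>i=1..n. f (x i)) = (\<Sum>k<n. f (sort (map x [1..<Suc n]) ! k))"
proof -
  let ?xs = "map x [1..<Suc n]"
  have "(\<Sum>i=1..n. f (x i)) = sum_list (map f ?xs)"
    by (simp add: sum_list_distinct_conv_sum_set atLeastLessThanSuc_atLeastAtMost comp_def del: upt_Suc)
  also have "\<dots> = sum_list (map f (sort ?xs))"
    by (metis mset_map mset_sort sum_mset_sum_list)
  also have "\<dots> = (\<Sum>k<n. f (sort ?xs ! k))"
    by (simp add: sum_list_sum_nth atLeast0LessThan del: upt_Suc)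
  finally show ?thesis .
qed

lemma ecdf_conv_sort:
  "ecdf n x t = real (card {k. k < n \<and> sort (map x [1..<Suc n]) ! k \<le> t}) / real n"
proof -
  have "(\<Sum>k<n. indicator {..t} (ys ! k) :: real) = real (card {k. k < n \<and> ys ! k \<le> t})" for ys
    using sum.inter_filter[of "{..<n}" "\<lambda>_. 1 :: real" "\<lambda>k. ys ! k \<le> t"]
    by (simp add: indicator_def of_bool_def)
  then show ?thesis
    unfolding ecdf_def sum_sample_conv_sort by simp
qed

text \<open>In a sorted list the positions with entry at most \<open>t\<close> form an initial
  segment, and a position lies in it iff it is below its length. Ties do no harm here.\<close>

lemma less_card_le_iff_sorted_nth:
  fixes ys :: "'b::linorder list"
  assumes "sorted ys" and "k < length ys"
  shows "k < card {j. j < length ys \<and> ys ! j \<le> t} \<longleftrightarrow> ys ! k \<le> t"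
proof
  assume "ys ! k \<le> t"
  then have "{..k} \<subseteq> {j. j < length ys \<and> ys ! j \<le> t}"
    using assms by (auto intro: order_trans[OF sorted_nth_mono])
  then have "card {..k} \<le> card {j. j < length ys \<and> ys ! j \<le> t}"
    by (intro card_mono) auto
  then show "k < card {j. j < length ys \<and> ys ! j \<le> t}"
    by simp
next
  assume card: "k < card {j. j < length ys \<and> ys ! j \<le> t}"
  show "ys ! k \<le> t"
  proof (rule ccontr)
    assume "\<not> ys ! k \<le> t"
    then have "{j. j < length ys \<and> ys ! j \<le> t} \<subseteq> {..<k}"
      using assms by (auto simp: not_le dest: sorted_nth_mono intro!: leI)
    then have "card {j. j < length ys \<and> ys ! j \<le> t} \<le> card {..<k}"
      by (intro card_mono) auto
    with card show False
      by simp
  qed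
qed

text \<open>This is where ties matter: an entry equal to \<open>ys ! k\<close> at a later position
  would raise the count above the rank. The successor appears because positions start at 0.\<close>

lemma card_le_nth_strict_sorted:
  fixes ys :: "'b::linorder list"
  assumes "sorted ys" and "distinct ys" and "k < length ys"
  shows "card {j. j < length ys \<and> ys ! j \<le> ys ! k} = Suc k"
proof -
  have "ys ! j \<le> ys ! k \<longleftrightarrow> j \<le> k" if "j < length ys" for j
    using assms that by (metis linorder_le_cases nth_eq_iff_index_eq order_antisym sorted_nth_mono)
  then have "{j. j < length ys \<and> ys ! j \<le> ys ! k} = {..k}"
    using assms(3) by auto
  then show ?thesis
    by simp
qed

lemma mean_ecdf_sample:
  assumes "inj_on x {1..n}"
  shows "(1 / real n) * (\<Sum>i=1..n. ecdf n x (x i)) = (real n + 1) / (2 * real n)"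
proof -
  let ?ys = "sort (map x [1..<Suc n])"
  have len: "length ?ys = n"
    by simp
  have dist: "distinct ?ys"
    using assms
    by (simp add: distinct_map atLeastLessThanSuc_atLeastAtMost del: upt_Suc)
  have "(\<Sum>i=1..n. ecdf n x (x i)) = (\<Sum>k<n. ecdf n x (?ys ! k))"
    by (rule sum_sample_conv_sort)
  also have "\<dots> = (\<Sum>k<n. (real k + 1) / real n)"
    using card_le_nth_strict_sorted[of ?ys, unfolded len] dist
    by (intro sum.cong refl) (simp add: ecdf_conv_sort del: upt_Suc)
  also have "\<dots> = (\<Sum>k<n. real k + 1) / real n"
    by (simp add: sum_divide_distrib)
  also have "(\<Sum>k<n. real k + 1) = real n * (real n + 1) / 2"
    by (induction n) (auto simp: field_simps)
  finally show ?thesis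
    \<comment> \<open>For \<open>n = 0\<close> both sides are 0, by the convention for division by
      zero.\<close>
    by (cases "n = 0") (simp_all add: field_simps)
qed

lemma b_int_eq_order_stat:
  assumes "n \<ge> 1" and "inj_on x {1..n}"
  shows "b_int n x = order_stat n x (n div 2 + 1)"
proof -
  let ?ys = "sort (map x [1..<Suc n])"
  have len: "length ?ys = n"
    by simp
  \<comment> \<open>The set whose infimum defines the generalised inverse is thus a closed
    half-line, and the infimum is its left endpoint.\<close>
  have "(real n + 1) / (2 * real n) \<le> ecdf n x t \<longleftrightarrow> ?ys ! (n div 2) \<le> t" for t
  proof -
    let ?c = "card {k. k < n \<and> ?ys ! k \<le> t}"
    have "(real n + 1) / (2 * real n) \<le> ecdf n x t \<longleftrightarrow> (real n + 1) / 2 / real n \<le> real ?c / real n"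
      by (simp add: ecdf_conv_sort del: upt_Suc)
    also have "\<dots> \<longleftrightarrow> real (n + 1) \<le> real (2 * ?c)"
      using assms(1) by (simp add: divide_le_cancel pos_divide_le_eq algebra_simps del: upt_Suc)
    also have "\<dots> \<longleftrightarrow> n + 1 \<le> 2 * ?c"
      by (rule of_nat_le_iff)
    \<comment> \<open>Integrality of the count decides the rank: for n = 2m as well as n = 2m + 1
      the condition says that the count is at least m + 1. For even n this selects the upper middle
      point.\<close>
    also have "\<dots> \<longleftrightarrow> n div 2 < ?c"
      by presburger
    also have "\<dots> \<longleftrightarrow> ?ys ! (n div 2) \<le> t"
      using less_card_le_iff_sorted_nth[of ?ys "n div 2" t, unfolded len] assms(1)
      by (simp del: upt_Suc)
    finally show ?thesis .
  qed
  then have "{t. (real n + 1) / (2 * real n) \<le> ecdf n x t} = {?ys ! (n div 2)..}"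
    by auto
  then show ?thesis
    unfolding b_int_def mean_ecdf_sample[OF assms(2)] gen_inverse_def order_stat_def
    by simp
qed

lemma nat_ceiling_half_Suc: "nat \<lceil>(real n + 1) / 2\<rceil> = n div 2 + 1"
proof -
  have "\<lceil>(real n + 1) / 2\<rceil> = int (n div 2 + 1)"
    by (rule ceiling_unique) (cases "even n"; auto elim!: evenE oddE)+
  then show ?thesis
    by (simp only: nat_int)
qed

text \<open>By independence the joint law is a product measure. Each section of the diagonal is a
  single point, null for the law of \<open>Y\<close>, so the diagonal is null by Fubini.\<close>

lemma (in prob_space) AE_indep_neq:
  fixes X Y :: "'a \<Rightarrow> real"
  assumes "indep_var borel X borel Y" and "\<And>a. measure (distr M borel Y) {a} = 0"
  shows "AE \<omega> in M. X \<omega> \<noteq> Y \<omega>"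
proof -
  have [measurable]: "random_variable borel X" "random_variable borel Y"
    and pair: "distr M borel X \<Otimes>\<^sub>M distr M borel Y = distr M (borel \<Otimes>\<^sub>M borel) (\<lambda>\<omega>. (X \<omega>, Y \<omega>))"
    using assms(1) unfolding indep_var_distribution_eq by auto
  interpret X: prob_space "distr M borel X"
    by (rule prob_space_distr) measurable
  interpret Y: prob_space "distr M borel Y"
    by (rule prob_space_distr) measurable
  interpret P: pair_sigma_finite "distr M borel X" "distr M borel Y" ..
  have diagonal: "{p \<in> space (borel \<Otimes>\<^sub>M borel). fst p \<noteq> (snd p :: real)} \<in> sets (borel \<Otimes>\<^sub>M borel)"
    by measurable
  have "AE y in distr M borel Y. a \<noteq> y" for a
    using assms(2)[of a] by (intro AE_I[of _ _ "{a}"]) (auto simp: Y.emeasure_eq_measure)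
  then have "AE p in distr M borel X \<Otimes>\<^sub>M distr M borel Y. fst p \<noteq> snd p"
    using diagonal by (intro P.AE_pair_measure) (auto simp: space_pair_measure)
  then have "AE p in distr M (borel \<Otimes>\<^sub>M borel) (\<lambda>\<omega>. (X \<omega>, Y \<omega>)). fst p \<noteq> snd p"
    unfolding pair .
  from AE_distrD[OF _ this] show ?thesis
    by simp
qed

lemma (in prob_space) AE_inj_on_sample:
  fixes X :: "'i \<Rightarrow> 'a \<Rightarrow> real"
  assumes "finite I" and "indep_vars (\<lambda>_. borel) X I"
    and "\<And>i a. i \<in> I \<Longrightarrow> measure (distr M borel (X i)) {a} = 0"
  shows "AE \<omega> in M. inj_on (\<lambda>i. X i \<omega>) I"
proof -
  have "AE \<omega> in M. X i \<omega> \<noteq> X j \<omega>" if "i \<in> I" "j \<in> I" "i \<noteq> j" for i j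
  proof (rule AE_indep_neq)
    have "indep_vars (\<lambda>_. borel) X (insert i {j})"
      using assms(2) by (rule indep_vars_subset) (use that in auto)
    \<comment> \<open>The sum over the singleton \<open>{j}\<close> is \<open>X j\<close> itself, so
      independence from a sum yields pairwise independence.\<close>
    from indep_vars_sum[OF _ _ this] show "indep_var borel (X i) borel (X j)"
      using that by simp
  qed (use assms(3) that in auto)
  then have "AE \<omega> in M. \<forall>i\<in>I. \<forall>j\<in>I. i \<noteq> j \<longrightarrow> X i \<omega> \<noteq> X j \<omega>"
    using assms(1) by (intro AE_finite_allI) auto
  then show ?thesis
    by eventually_elim (auto simp: inj_on_def)
qed

theorem theorem4p2:
  fixes M :: "'a measure" and X :: "nat \<Rightarrow> 'a \<Rightarrow> real" and n :: nat
    and \<mu> :: "real measure" and F :: "real \<Rightarrow> real"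
  assumes "prob_space M"
    and "n \<ge> 1"
    and "prob_space.indep_vars M (\<lambda>_. borel) X {1..n}"
    and "\<And>i. i \<in> {1..n} \<Longrightarrow> distr M borel (X i) = \<mu>"
    and "F = cdf \<mu>"
    and "continuous_on UNIV F"
  shows "AE \<omega> in M.
      b_int n (\<lambda>i. X i \<omega>) = order_stat n (\<lambda>i. X i \<omega>) (nat \<lceil>(real n + 1) / 2\<rceil>)
    \<and> (odd n \<longrightarrow> b_int n (\<lambda>i. X i \<omega>) = sample_median n (\<lambda>i. X i \<omega>))
    \<and> (even n \<longrightarrow> b_int n (\<lambda>i. X i \<omega>) = order_stat n (\<lambda>i. X i \<omega>) (n div 2 + 1))"
proof -
  interpret prob_space M
    by fact
  have rv [measurable]: "random_variable borel (X i)" if "i \<in> {1..n}" for i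
    using assms(3) that unfolding indep_vars_def by auto
  \<comment> \<open>The mass of a point is the jump of the CDF there, so continuity of
    \<open>F\<close> rules out atoms.\<close>
  have "measure (distr M borel (X i)) {a} = 0" if "i \<in> {1..n}" for i a
  proof -
    interpret D: real_distribution "distr M borel (X i)"
      using rv[OF that] by (rule real_distribution_distr)
    show ?thesis
      using assms(4)[OF that] assms(5,6) D.isCont_cdf[of a]
      by (simp add: continuous_on_eq_continuous_at)
  qed
  then have "AE \<omega> in M. inj_on (\<lambda>i. X i \<omega>) {1..n}"
    by (intro AE_inj_on_sample assms(3)) auto
  then show ?thesis
  proof eventually_elim
    case (elim \<omega>)
    \<comment> \<open>For odd n the median rank \<open>(n + 1) div 2\<close> equals
      \<open>n div 2 + 1\<close>.\<close>
    from b_int_eq_order_stat[OF assms(2) this]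
    show ?case
      unfolding nat_ceiling_half_Suc sample_median_def by (auto elim!: oddE)
  qed
qed

end
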